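(* Let $(X,d)$ be a locally compact metric space. Suppose that for some $x_0\in X$ there exists a continuous injective monoid homomorphism $F:([0,\infty),\times)\to(C_{x_0}(X),\circ)$ such that $F(0)$ is the constant map with value $x_0$ and $F(1)=\mathrm{Id}_X$. If $d(F(\alpha)(x),x_0)<d(x,x_0)$ for all $\alpha\in[0,1)$ and all $x\in X\setminus\{x_0\}$, then for all sufficiently small $\varepsilon>0$ the function $f':\mathcal{C}_{x_0}([0,\infty),\mathrm{Bd}(B(x_0;\varepsilon)))\to X$ defined by $x_0\mapsto x_0$ and $(\alpha,c)\mapsto F(\alpha)(c)$ for $\alpha\in(0,\infty)$, $c\in\mathrm{Bd}(B(x_0;\varepsilon))$, is a homeomorphism.
   Context: $C_{x_0}(X)$ is the set of continuous maps $f:X\to X$ with $f(x_0)=x_0$, a monoid under composition, equipped with the subspace topology induced by the compact-open topology. The monoid $([0,\infty),\times)$ is $[0,\infty)$ with multiplication and the usual topology. $B(x_0;\varepsilon)$ is the open ball with respect to $d$ and $\mathrm{Bd}$ denotes topological boundary in $X$. Cone: for a topological space $C$, a set $I\subset\mathbb{R}_{\ge0}$ containing $0$, and a point $p$, $\mathcal{C}_p(I,C)$ is the quotient space obtained from $I\times C$ by identifying $\{0\}\times C$ to the single point $p$; as a set it is $\{p\}\sqcup (I\setminus\{0\})\times C$, and it carries the quotient topology. *)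

theory Defs
  imports "HOL-Analysis.Analysis"
begin

definition compact_open_topology :: "('a::topological_space \<Rightarrow> 'b::topological_space) topology" where
  "compact_open_topology =
     topology_generated_by {{f. continuous_on UNIV f \<and> f ` K \<subseteq> U} |K U. compact K \<and> open U}"

lemma topspace_compact_open_topology:
  "topspace (compact_open_topology :: ('a::topological_space \<Rightarrow> 'b::topological_space) topology)
     = {f. continuous_on UNIV f}"
proof -
  let ?B = "{{f :: 'a \<Rightarrow> 'b. continuous_on UNIV f \<and> f ` K \<subseteq> U} |K U. compact K \<and> open U}"
  have "{f :: 'a \<Rightarrow> 'b. continuous_on UNIV f} \<in> ?B"
    by (rule CollectI, rule exI[of _ "{}"], rule exI[of _ UNIV]) simp
  then have "{f :: 'a \<Rightarrow> 'b. continuous_on UNIV f} \<subseteq> \<Union>?B"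
    by (rule Union_upper)
  moreover have "\<Union>?B \<subseteq> {f :: 'a \<Rightarrow> 'b. continuous_on UNIV f}"
    by (rule Union_least) blast
  ultimately show ?thesis
    unfolding compact_open_topology_def topology_generated_by_topspace by (rule equalityI[rotated])
qed

definition pointed_maps :: "'a::topological_space \<Rightarrow> ('a \<Rightarrow> 'a) set" where
  "pointed_maps x0 = {f. continuous_on UNIV f \<and> f x0 = x0}"

abbreviation pointed_maps_topology :: "'a::topological_space \<Rightarrow> ('a \<Rightarrow> 'a) topology" where
  "pointed_maps_topology x0 \<equiv> subtopology compact_open_topology (pointed_maps x0)"

text \<open>The cone with apex \<open>p\<close> is carried by the disjoint union of \<open>{p}\<close> and \<open>(I - {0}) \<times> C\<close>; it has
  the quotient topology induced by the projection from \<open>I \<times> C\<close> that collapses \<open>{0} \<times> C\<close> to \<open>p\<close>.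
  The carrier is given explicitly because the projection misses \<open>p\<close> when \<open>C\<close> is empty.\<close>

definition cone_carrier :: "'p \<Rightarrow> real set \<Rightarrow> 'c set \<Rightarrow> ('p + real \<times> 'c) set" where
  "cone_carrier p I C = {p} <+> (I - {0}) \<times> C"

definition cone_proj :: "'p \<Rightarrow> real \<times> 'c \<Rightarrow> 'p + real \<times> 'c" where
  "cone_proj p = (\<lambda>(t, c). if t = 0 then Inl p else Inr (t, c))"

definition cone_topology :: "'p \<Rightarrow> real set \<Rightarrow> 'c topology \<Rightarrow> ('p + real \<times> 'c) topology" where
  "cone_topology p I C = topology (\<lambda>U. U \<subseteq> cone_carrier p I (topspace C) \<and>
     openin (prod_topology (top_of_set I) C) {z \<in> I \<times> topspace C. cone_proj p z \<in> U})"

lemma openin_cone_topology: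
  "openin (cone_topology p I C) U \<longleftrightarrow> U \<subseteq> cone_carrier p I (topspace C) \<and>
     openin (prod_topology (top_of_set I) C) {z \<in> I \<times> topspace C. cone_proj p z \<in> U}"
proof -
  let ?X = "prod_topology (top_of_set I) C"
  let ?P = "\<lambda>U. {z \<in> I \<times> topspace C. cone_proj p z \<in> U}"
  have "openin ?X (?P (S \<inter> T))" if "openin ?X (?P S)" "openin ?X (?P T)" for S T
  proof -
    have "?P (S \<inter> T) = ?P S \<inter> ?P T" by blast
    then show ?thesis using openin_Int[OF that] by (simp only:)
  qed
  moreover have "openin ?X (?P (\<Union>K))" if "\<forall>S\<in>K. openin ?X (?P S)" for K
  proof -
    have "?P (\<Union>K) = \<Union>(?P ` K)" by blast
    then show ?thesis using that by (auto intro!: openin_Union)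
  qed
  ultimately have "istopology (\<lambda>U. U \<subseteq> cone_carrier p I (topspace C) \<and> openin ?X (?P U))"
    unfolding istopology_def by (intro conjI allI impI) (blast, simp, blast, simp)
  then show ?thesis
    unfolding cone_topology_def by (simp add: topology_inverse')
qed

lemma topspace_cone_topology:
  "topspace (cone_topology p I C) = cone_carrier p I (topspace C)"
proof -
  have "{z \<in> I \<times> topspace C. cone_proj p z \<in> cone_carrier p I (topspace C)}
      = topspace (prod_topology (top_of_set I) C)"
    by (auto simp: cone_proj_def cone_carrier_def)
  then have "openin (cone_topology p I C) (cone_carrier p I (topspace C))"
    unfolding openin_cone_topology by (simp only: openin_topspace subset_refl simp_thms)
  then show ?thesis
    using openin_topspace[of "cone_topology p I C"]
    by (intro equalityI openin_subset) (simp only: openin_cone_topology)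
qed

lemma quotient_map_cone_proj:
  assumes "0 \<in> I" "topspace C \<noteq> {}"
  shows "quotient_map (prod_topology (top_of_set I) C) (cone_topology p I C) (cone_proj p)"
proof -
  have "cone_proj p ` (I \<times> topspace C) = cone_carrier p I (topspace C)"
  proof
    show "cone_proj p ` (I \<times> topspace C) \<subseteq> cone_carrier p I (topspace C)"
      by (auto simp: cone_proj_def cone_carrier_def)
    show "cone_carrier p I (topspace C) \<subseteq> cone_proj p ` (I \<times> topspace C)"
    proof
      fix y assume "y \<in> cone_carrier p I (topspace C)"
      then consider "y = Inl p" | t c where "t \<in> I" "t \<noteq> 0" "c \<in> topspace C" "y = Inr (t, c)"
        by (auto simp: cone_carrier_def)
      then show "y \<in> cone_proj p ` (I \<times> topspace C)"
      proof cases
        case 1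
        obtain c where "c \<in> topspace C" using assms(2) by blast
        then show ?thesis
          using 1 assms(1) by (intro image_eqI[of _ _ "(0, c)"]) (simp_all add: cone_proj_def)
      next
        case 2
        then show ?thesis
          by (intro image_eqI[of _ _ "(t, c)"]) (simp_all add: cone_proj_def)
      qed
    qed
  qed
  then show ?thesis
    by (simp add: quotient_map_def topspace_cone_topology openin_cone_topology)
qed

fun cone_map :: "'a \<Rightarrow> (real \<Rightarrow> 'c \<Rightarrow> 'a) \<Rightarrow> 'a + real \<times> 'c \<Rightarrow> 'a" where
  "cone_map x0 F (Inl _) = x0"
| "cone_map x0 F (Inr (\<alpha>, c)) = F \<alpha> c"

end

theory Submission
  imports Defs
begin

text \<open>
  Since \<open>F\<close> is continuous into the compact-open topology, the action \<open>(t, x) \<mapsto> F t x\<close> is jointly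
  continuous. The contraction hypothesis makes \<open>t \<mapsto> dist (F t x) x0\<close> strictly increasing for
  \<open>x \<noteq> x0\<close>, so an orbit meets a sphere about \<open>x0\<close> at most once. It meets every small sphere: an
  orbit inside a compact ball would accumulate, as \<open>t \<rightarrow> \<infinity>\<close>, at a point \<open>y \<noteq> x0\<close> for which \<open>y\<close> and
  \<open>F 2 y\<close> have the same distance to \<open>x0\<close>. Hence the cone map is a continuous bijection. It is
  closed: if \<open>F (a n) (c n)\<close> converges with \<open>c n\<close> on the sphere, then \<open>a n\<close> is bounded, as otherwise
  \<open>c n = F (1 / a n) (F (a n) (c n))\<close> would tend to \<open>x0\<close> along a subsequence, and compactness
  of the sphere applies.
\<close>

section \<open>Joint continuity from the compact-open topology\<close>

text \<open>A tail of \<open>x\<close> together with its limit \<open>y\<close> is a compact set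
  \<open>K\<close>, so the maps sending \<open>K\<close> into \<open>U\<close> form a subbasic
  neighbourhood of \<open>F l\<close>, which eventually contains \<open>F (t n)\<close>.\<close>

lemma compact_open_imp_tendsto_eval:
  fixes F :: "'t::topological_space \<Rightarrow> 'a::metric_space \<Rightarrow> 'b::topological_space"
  assumes F: "continuous_map (top_of_set T) compact_open_topology F"
    and t: "t \<longlonglongrightarrow> l" "\<And>n::nat. t n \<in> T" "l \<in> T"
    and x: "x \<longlonglongrightarrow> y"
  shows "(\<lambda>n. F (t n) (x n)) \<longlonglongrightarrow> F l y"
proof (rule topological_tendstoI)
  fix U assume U: "open U" "F l y \<in> U"
  have cont: "continuous_on UNIV (F l)"
    using continuous_map_funspace[OF F] t(3) by (auto simp: topspace_compact_open_topology)
  have "open (F l -` U)"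
    using cont U(1) by (simp add: open_vimage)
  then have "eventually (\<lambda>n. x n \<in> F l -` U) sequentially"
    using U(2) by (intro topological_tendstoD[OF x]) auto
  then obtain N where N: "\<And>n. n \<ge> N \<Longrightarrow> F l (x n) \<in> U"
    by (auto simp: eventually_sequentially)
  \<comment> \<open>Dropping the first \<open>N\<close> terms ensures that \<open>F l\<close> sends
    all of \<open>K\<close> into \<open>U\<close>.\<close>
  define K where "K = insert y (range (\<lambda>n. x (n + N)))"
  define W where "W = {f :: 'a \<Rightarrow> 'b. continuous_on UNIV f \<and> f ` K \<subseteq> U}"
  have "compact K"
    using compactin_sequence_with_limit[of euclidean "\<lambda>n. x (n + N)" y]
      LIMSEQ_ignore_initial_segment[OF x] by (auto simp: K_def)
  then have "openin compact_open_topology W"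
    unfolding compact_open_topology_def W_def using U(1)
    by (intro topology_generated_by_Basis) blast
  then have "openin (top_of_set T) {s \<in> T. F s \<in> W}"
    using openin_continuous_map_preimage[OF F] by simp
  then obtain O' where O': "open O'" "{s \<in> T. F s \<in> W} = T \<inter> O'"
    by (auto simp: openin_open)
  have "F l \<in> W"
    using cont U(2) N by (auto simp: W_def K_def)
  then have "l \<in> O'"
    using O'(2) t(3) by blast
  then have "eventually (\<lambda>n. t n \<in> O') sequentially"
    using t(1) O'(1) by (simp add: topological_tendstoD)
  then show "eventually (\<lambda>n. F (t n) (x n) \<in> U) sequentially"
    using eventually_ge_at_top[of N]
  proof eventually_elim
    case (elim n)
    then have "F (t n) \<in> W"
      using O'(2) t(2) by blast
    moreover have "x n \<in> K"
      unfolding K_def using elim(2) by (intro insertI2 image_eqI[of _ _ "n - N"]) auto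
    ultimately show ?case
      by (auto simp: W_def)
  qed
qed

lemma locally_compact_space_imp_compact_cball:
  fixes x :: "'a::metric_space"
  assumes "locally_compact_space (euclidean :: 'a topology)"
  obtains r where "r > 0" "compact (cball x r)"
proof -
  obtain U K where UK: "open U" "compact K" "x \<in> U" "U \<subseteq> K"
    using assms unfolding locally_compact_space_def
    by (metis UNIV_I compactin_euclidean_iff open_openin topspace_euclidean)
  then obtain r where "r > 0" "cball x r \<subseteq> U"
    using open_contains_cball by blast
  moreover then have "compact (cball x r)"
    using UK compact_Int_closed[of K "cball x r"] by (metis closed_cball inf.absorb2 order_trans)
  ultimately show ?thesis
    using that by blast
qed

section \<open>Contracting actions of the multiplicative half-line\<close>

text \<open>The compact-open topology enters only through sequential joint continuity of the action,
  which gives joint continuity because parameters and points both range over metric spaces.\<close>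

locale contracting_action =
  fixes F :: "real \<Rightarrow> 'a::metric_space \<Rightarrow> 'a" and x0 :: 'a
  assumes eval_tendsto: "\<And>t l x y. \<lbrakk>t \<longlonglongrightarrow> l; \<And>n::nat. t n \<ge> 0; l \<ge> 0; x \<longlonglongrightarrow> y\<rbrakk>
      \<Longrightarrow> (\<lambda>n. F (t n) (x n)) \<longlonglongrightarrow> F l y"
    and act_mult: "\<And>a b x. \<lbrakk>a \<ge> 0; b \<ge> 0\<rbrakk> \<Longrightarrow> F (a * b) x = F a (F b x)"
    and act_0: "\<And>x. F 0 x = x0"
    and act_1: "\<And>x. F 1 x = x"
    and act_base: "\<And>a. a \<ge> 0 \<Longrightarrow> F a x0 = x0"
    and contract: "\<And>a x. \<lbrakk>0 \<le> a; a < 1; x \<noteq> x0\<rbrakk> \<Longrightarrow> dist (F a x) x0 < dist x x0"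
begin

lemma act_inverse:
  assumes "a > 0"
  shows "F (1 / a) (F a x) = x"
  using assms act_mult[of "1 / a" a x] by (simp_all add: act_1)

lemma act_eq_base_iff: "a > 0 \<Longrightarrow> F a x = x0 \<longleftrightarrow> x = x0"
  by (metis act_inverse act_base less_imp_le zero_less_divide_1_iff)

text \<open>\<open>F s x\<close> is the contraction by \<open>s / t < 1\<close> of the point
  \<open>F t x\<close>, which differs from \<open>x0\<close> because \<open>F t\<close> is
  invertible and fixes \<open>x0\<close>.\<close>

lemma dist_act_strict_mono:
  assumes "x \<noteq> x0" "0 \<le> s" "s < t"
  shows "dist (F s x) x0 < dist (F t x) x0"
proof -
  have "F s x = F (s / t) (F t x)"
    using assms act_mult[of "s / t" t x] by simp
  then show ?thesis
    using assms contract[of "s / t" "F t x"] by (simp add: act_eq_base_iff)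
qed

lemma dist_act_mono:
  assumes "0 \<le> s" "s \<le> t"
  shows "dist (F s x) x0 \<le> dist (F t x) x0"
proof (cases "x = x0 \<or> s = t")
  case True
  then show ?thesis using assms by (auto simp: act_base)
next
  case False
  then show ?thesis using assms dist_act_strict_mono[of x s t] by simp
qed

lemma continuous_on_eval: "continuous_on ({0..} \<times> S) (\<lambda>(t, x). F t x)"
proof (rule continuous_on_sequentiallyI)
  fix u :: "nat \<Rightarrow> real \<times> 'a" and z
  assume u: "\<forall>n. u n \<in> {0..} \<times> S" "z \<in> {0..} \<times> S" "u \<longlonglongrightarrow> z"
  have "(\<lambda>n. F (fst (u n)) (snd (u n))) \<longlonglongrightarrow> F (fst z) (snd z)"
  proof (rule eval_tendsto)
    show "fst (u n) \<ge> 0" for n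
      using u(1) by (auto simp: mem_Times_iff)
  qed (use u(2) tendsto_fst[OF u(3)] tendsto_snd[OF u(3)] in auto)
  then show "(\<lambda>n. case u n of (t, x) \<Rightarrow> F t x) \<longlonglongrightarrow> (case z of (t, x) \<Rightarrow> F t x)"
    by (simp add: case_prod_beta)
qed

lemma continuous_on_orbit: "continuous_on {0..} (\<lambda>t. F t x)"
proof -
  have "continuous_on {0..} (\<lambda>t. (t, x))"
    by (intro continuous_intros)
  from continuous_on_compose2[OF continuous_on_eval[of UNIV] this] show ?thesis
    by (simp add: image_subset_iff)
qed

section \<open>Spheres about the base point and the orbits crossing them\<close>

text \<open>In a general metric space the frontier of a ball can be smaller than the sphere. Here
  each point \<open>x\<close> of the sphere is the limit of \<open>F t x\<close> as \<open>t\<close>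
  increases to 1, and these points lie in the ball by contraction.\<close>

lemma frontier_ball_eq_sphere:
  assumes "r > 0"
  shows "frontier (ball x0 r) = sphere x0 r"
proof
  have "closure (ball x0 r) \<subseteq> cball x0 r"
    by (intro closure_minimal) auto
  then show "frontier (ball x0 r) \<subseteq> sphere x0 r"
    by (auto simp: frontier_def)
  show "sphere x0 r \<subseteq> frontier (ball x0 r)"
  proof
    fix x assume x: "x \<in> sphere x0 r"
    define t :: "nat \<Rightarrow> real" where "t n = 1 - 1 / Suc n" for n
    have "t \<longlonglongrightarrow> 1 - 0"
      unfolding t_def using LIMSEQ_inverse_real_of_nat
      by (intro tendsto_diff tendsto_const) (simp add: inverse_eq_divide)
    moreover have t: "0 \<le> t n" "t n < 1" for n
      by (simp_all add: t_def)
    ultimately have "(\<lambda>n. F (t n) x) \<longlonglongrightarrow> F 1 x"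
      by (intro eval_tendsto) auto
    moreover have "F (t n) x \<in> ball x0 r" for n
      using contract[OF t, of x] x assms by (auto simp: dist_commute)
    ultimately have "x \<in> closure (ball x0 r)"
      unfolding closure_sequential act_1 by (intro exI[of _ "\<lambda>n. F (t n) x"]) auto
    then show "x \<in> frontier (ball x0 r)"
      using x by (simp add: frontier_def)
  qed
qed

lemma orbit_leaves_compact_cball:
  assumes K: "compact (cball x0 r)" and x: "x \<noteq> x0"
  shows "\<exists>t\<ge>0. dist (F t x) x0 > r"
proof (rule ccontr)
  assume "\<not> (\<exists>t\<ge>0. dist (F t x) x0 > r)"
  then have bd: "dist (F t x) x0 \<le> r" if "t \<ge> 0" for t
    using that not_le by blast
  define g where "g n = dist (F (real n) x) x0" for n
  have "incseq g"
    by (intro incseq_SucI) (simp add: g_def dist_act_mono)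
  moreover have "g n \<le> r" for n
    by (simp add: g_def bd)
  ultimately obtain L where L: "g \<longlonglongrightarrow> L"
    using incseq_convergent by blast
  have "\<forall>n. F (real n) x \<in> cball x0 r"
    using bd by (simp add: dist_commute)
  then obtain y \<sigma> where \<sigma>: "strict_mono \<sigma>" "((\<lambda>n. F (real n) x) \<circ> \<sigma>) \<longlonglongrightarrow> y"
    using K unfolding compact_def by metis
  have "(\<lambda>n. dist (((\<lambda>n. F (real n) x) \<circ> \<sigma>) n) x0) \<longlonglongrightarrow> dist y x0"
    by (intro tendsto_intros \<sigma>(2))
  moreover have "(g \<circ> \<sigma>) \<longlonglongrightarrow> L"
    using L \<sigma>(1) by (rule LIMSEQ_subseq_LIMSEQ)
  ultimately have y: "dist y x0 = L"
    using LIMSEQ_unique by (fastforce simp: g_def o_def)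
  have "(\<lambda>n. F 2 (((\<lambda>n. F (real n) x) \<circ> \<sigma>) n)) \<longlonglongrightarrow> F 2 y"
    by (intro eval_tendsto[OF tendsto_const _ _ \<sigma>(2)]) auto
  then have "(\<lambda>n. dist (F 2 (F (real (\<sigma> n)) x)) x0) \<longlonglongrightarrow> dist (F 2 y) x0"
    by (auto intro!: tendsto_intros simp: o_def)
  \<comment> \<open>Doubling an integer time gives an integer time, so the distances after applying
    \<open>F 2\<close> form another subsequence of \<open>g\<close> and have the same limit
    \<open>L\<close>.\<close>
  moreover have "dist (F 2 (F (real (\<sigma> n)) x)) x0 = (g \<circ> (\<lambda>n. 2 * \<sigma> n)) n" for n
    by (simp add: g_def act_mult)
  moreover have "(g \<circ> (\<lambda>n. 2 * \<sigma> n)) \<longlonglongrightarrow> L"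
    using L \<sigma>(1) by (intro LIMSEQ_subseq_LIMSEQ) (auto simp: strict_mono_def)
  ultimately have "dist (F 2 y) x0 = dist y x0"
    using LIMSEQ_unique y by (fastforce simp: o_def)
  moreover have "y \<noteq> x0"
  proof
    assume "y = x0"
    moreover have "g 1 \<le> L"
      using \<open>incseq g\<close> L by (rule incseq_le)
    ultimately show False
      using x y by (simp add: g_def act_1)
  qed
  ultimately show False
    using dist_act_strict_mono[of y 1 2] by (simp add: act_1)
qed

text \<open>The distance to \<open>x0\<close> along the orbit is continuous, starts at 0 and exceeds
  \<open>r\<close>, so it takes the value \<open>e\<close> by the intermediate value
  theorem.\<close>

lemma orbit_meets_sphere:
  assumes "compact (cball x0 r)" "x \<noteq> x0" "0 < e" "e \<le> r"
  obtains t where "t > 0" "F t x \<in> sphere x0 e"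
proof -
  obtain T where T: "T \<ge> 0" "dist (F T x) x0 > r"
    using orbit_leaves_compact_cball assms(1,2) by blast
  have "continuous_on {0..T} (\<lambda>t. dist (F t x) x0)"
    by (intro continuous_intros continuous_on_subset[OF continuous_on_orbit]) auto
  then obtain t where t: "0 \<le> t" "dist (F t x) x0 = e"
    using IVT'[of "\<lambda>t. dist (F t x) x0" 0 e T] T assms(3,4) by (auto simp: act_0)
  moreover have "t \<noteq> 0"
    using t(2) assms(3) by (auto simp: act_0)
  ultimately show ?thesis
    using that[of t] by (simp add: dist_commute)
qed

text \<open>The two points lie on one orbit, \<open>c = F (b / a) d\<close>, at equal distance from
  \<open>x0\<close>; strict monotonicity along that orbit forces \<open>b / a = 1\<close>.\<close>

lemma act_sphere_inj:
  assumes eq: "F a c = F b d" and ab: "a > 0" "b > 0"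
    and c: "c \<in> sphere x0 e" and d: "d \<in> sphere x0 e" and "e > 0"
  shows "a = b \<and> c = d"
proof -
  have "c = F (1 / a) (F b d)"
    using act_inverse[of a c] eq ab by simp
  then have c': "c = F (b / a) d"
    using act_mult[of "1 / a" b d] ab by simp
  have "d \<noteq> x0" "dist (F (b / a) d) x0 = dist (F 1 d) x0"
    using c d c' \<open>e > 0\<close> by (auto simp: dist_commute act_1)
  then have "b / a = 1"
    using dist_act_strict_mono[of d "b / a" 1] dist_act_strict_mono[of d 1 "b / a"] ab
    by (metis divide_pos_pos less_eq_real_def less_irrefl linorder_neqE zero_le_one)
  then show ?thesis
    using c' ab by (simp add: act_1)
qed

section \<open>Closed images under the action\<close>

text \<open>Compactness of \<open>S\<close> controls the points \<open>c n\<close>, but the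
  half-line of parameters is not compact; the main task is to keep \<open>a n\<close> from escaping
  to infinity.\<close>

lemma closed_act_image:
  assumes S: "compact S" "x0 \<notin> S"
    and P: "closedin (top_of_set ({0..} \<times> S)) P"
  shows "closed ((\<lambda>(t, c). F t c) ` P)"
  unfolding closed_sequential_limits
proof (intro allI impI, elim conjE)
  fix w x
  assume w: "\<forall>n. w n \<in> (\<lambda>(t, c). F t c) ` P" "w \<longlonglongrightarrow> x"
  have P_sub: "P \<subseteq> {0..} \<times> S"
    using closedin_subset[OF P] by simp
  have "\<forall>n. \<exists>p. p \<in> P \<and> w n = F (fst p) (snd p)"
    using w(1) by (fastforce simp: image_iff)
  then obtain p where p: "\<And>n. p n \<in> P" "\<And>n. w n = F (fst (p n)) (snd (p n))"
    by metis
  define a where "a n = fst (p n)" for n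
  define c where "c n = snd (p n)" for n
  have ac: "a n \<ge> 0" "c n \<in> S" "w n = F (a n) (c n)" "(a n, c n) \<in> P" for n
    using p[of n] P_sub by (auto simp: a_def c_def)
  obtain d \<sigma> where \<sigma>: "d \<in> S" "strict_mono \<sigma>" "(c \<circ> \<sigma>) \<longlonglongrightarrow> d"
    using S(1) ac(2) unfolding compact_def by metis
  have w\<sigma>: "(w \<circ> \<sigma>) \<longlonglongrightarrow> x"
    using w(2) \<sigma>(2) by (rule LIMSEQ_subseq_LIMSEQ)
  have "Bseq (a \<circ> \<sigma>)"
  proof (rule ccontr)
    assume nb: "\<not> Bseq (a \<circ> \<sigma>)"
    \<comment> \<open>If this failed for some \<open>k\<close>, the tail from \<open>k\<close> on
      would be bounded. The resulting indices \<open>\<nu> k \<ge> k\<close> tend to infinity, which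
      suffices for passing to limits even if they are not strictly increasing.\<close>
    have "\<exists>n\<ge>k. a (\<sigma> n) > real (Suc k)" for k
    proof (rule ccontr)
      assume "\<not> (\<exists>n\<ge>k. a (\<sigma> n) > real (Suc k))"
      then have "eventually (\<lambda>n. norm ((a \<circ> \<sigma>) n) \<le> real (Suc k)) sequentially"
        using ac(1) unfolding eventually_sequentially by (auto simp: not_less)
      then show False
        using nb BfunI by blast
    qed
    then obtain \<nu> where \<nu>: "\<And>k. \<nu> k \<ge> k" "\<And>k. a (\<sigma> (\<nu> k)) > real (Suc k)"
      by metis
    have pos: "a (\<sigma> (\<nu> k)) > 0" for k
      using \<nu>(2)[of k] by linarith
    have "filterlim \<nu> sequentially sequentially"
      by (rule filterlim_at_top_mono[OF filterlim_ident]) (simp add: \<nu>(1))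
    then have w\<nu>: "(\<lambda>k. (w \<circ> \<sigma>) (\<nu> k)) \<longlonglongrightarrow> x" and c\<nu>: "(\<lambda>k. (c \<circ> \<sigma>) (\<nu> k)) \<longlonglongrightarrow> d"
      by (rule filterlim_compose[OF w\<sigma>], rule filterlim_compose[OF \<sigma>(3)])
    have inv_le: "1 / a (\<sigma> (\<nu> k)) \<le> inverse (real (Suc k))" for k
      unfolding inverse_eq_divide using \<nu>(2)[of k] by (intro divide_left_mono) auto
    have "(\<lambda>k. 1 / a (\<sigma> (\<nu> k))) \<longlonglongrightarrow> 0"
      by (rule tendsto_sandwich[OF _ _ tendsto_const LIMSEQ_inverse_real_of_nat])
        (use inv_le ac(1) in \<open>auto intro!: always_eventually\<close>)
    \<comment> \<open>Undoing the action recovers the points of \<open>S\<close>, yet the inverse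
      parameters tend to 0, so the limit is \<open>F 0 x = x0\<close>, which lies outside
      \<open>S\<close>.\<close>
    then have "(\<lambda>k. F (1 / a (\<sigma> (\<nu> k))) ((w \<circ> \<sigma>) (\<nu> k))) \<longlonglongrightarrow> F 0 x"
      using ac(1) by (intro eval_tendsto w\<nu>) auto
    moreover have "F (1 / a (\<sigma> (\<nu> k))) ((w \<circ> \<sigma>) (\<nu> k)) = (c \<circ> \<sigma>) (\<nu> k)" for k
      using ac(3) pos by (simp add: act_inverse)
    ultimately have "d = x0"
      using c\<nu> LIMSEQ_unique by (fastforce simp: act_0)
    then show False
      using \<sigma>(1) S(2) by simp
  qed
  then have "bounded (range (a \<circ> \<sigma>))"
    by (simp add: Bseq_eq_bounded)
  then obtain l \<tau> where \<tau>: "strict_mono \<tau>" "(a \<circ> \<sigma> \<circ> \<tau>) \<longlonglongrightarrow> l"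
    using bounded_imp_convergent_subsequence[of "a \<circ> \<sigma>"] by blast
  have c\<tau>: "(c \<circ> \<sigma> \<circ> \<tau>) \<longlonglongrightarrow> d" and w\<tau>: "(w \<circ> \<sigma> \<circ> \<tau>) \<longlonglongrightarrow> x"
    using \<sigma>(3) w\<sigma> \<tau>(1) by (auto intro: LIMSEQ_subseq_LIMSEQ)
  have "l \<ge> 0"
    using ac(1) by (intro LIMSEQ_le_const[OF \<tau>(2)]) auto
  have "(\<lambda>n. F ((a \<circ> \<sigma> \<circ> \<tau>) n) ((c \<circ> \<sigma> \<circ> \<tau>) n)) \<longlonglongrightarrow> F l d"
    using ac(1) \<open>l \<ge> 0\<close> by (intro eval_tendsto \<tau>(2) c\<tau>) auto
  then have "x = F l d"
    using w\<tau> LIMSEQ_unique ac(3) by (fastforce simp: o_def)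
  moreover have "(l, d) \<in> P"
  proof -
    obtain Q where Q: "closed Q" "P = ({0..} \<times> S) \<inter> Q"
      using P by (auto simp: closedin_closed)
    have "(\<lambda>n. ((a \<circ> \<sigma> \<circ> \<tau>) n, (c \<circ> \<sigma> \<circ> \<tau>) n)) \<longlonglongrightarrow> (l, d)"
      by (intro tendsto_Pair \<tau>(2) c\<tau>)
    then have "(l, d) \<in> Q"
    proof (rule closed_sequentially[OF Q(1), rotated])
      show "((a \<circ> \<sigma> \<circ> \<tau>) n, (c \<circ> \<sigma> \<circ> \<tau>) n) \<in> Q" for n
        using ac(4) Q(2) by auto
    qed
    then show ?thesis
      using Q(2) \<sigma>(1) \<open>l \<ge> 0\<close> by auto
  qed
  ultimately show "x \<in> (\<lambda>(t, c). F t c) ` P"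
    by (intro image_eqI[of _ _ "(l, d)"]) auto
qed

section \<open>Topology of the cone map\<close>

text \<open>Openness in the cone is tested on pullbacks along \<open>cone_proj\<close>. Since
  \<open>F 0\<close> is constantly \<open>x0\<close>, the cone map composed with the projection is
  the action, which is jointly continuous.\<close>

lemma continuous_map_cone_map:
  "continuous_map (cone_topology x0 {0..} (top_of_set S)) euclidean (cone_map x0 F)"
proof -
  have "openin (cone_topology x0 {0..} (top_of_set S))
      {z \<in> cone_carrier x0 {0..} S. cone_map x0 F z \<in> U}" if "open U" for U
  proof -
    have "{z \<in> {0..} \<times> S. cone_proj x0 z \<in> {z \<in> cone_carrier x0 {0..} S. cone_map x0 F z \<in> U}}
        = {z \<in> {0..} \<times> S. (\<lambda>(t, x). F t x) z \<in> U}"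
      by (auto simp: cone_proj_def cone_carrier_def act_0 split: if_splits)
    moreover have "openin (top_of_set ({0..} \<times> S)) {z \<in> {0..} \<times> S. (\<lambda>(t, x). F t x) z \<in> U}"
      using continuous_openin_preimage_gen[OF continuous_on_eval that]
      by (simp add: vimage_def Int_def)
    ultimately show ?thesis
      by (auto simp: openin_cone_topology prod_topology_subtopology_eu)
  qed
  then show ?thesis
    by (auto simp: continuous_map_def topspace_cone_topology)
qed

lemma closed_map_cone_map:
  assumes S: "compact S" "x0 \<notin> S"
  shows "closed_map (cone_topology x0 {0..} (top_of_set S)) euclidean (cone_map x0 F)"
  unfolding closed_map_def
proof (intro allI impI)
  fix A assume A: "closedin (cone_topology x0 {0..} (top_of_set S)) A"
  define P where "P = {z \<in> {0..} \<times> S. cone_proj x0 z \<in> A}"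
  have A_sub: "A \<subseteq> cone_carrier x0 {0..} S"
    using closedin_subset[OF A] by (simp add: topspace_cone_topology)
  have "{0..} \<times> S - P = {z \<in> {0..} \<times> S. cone_proj x0 z \<in> cone_carrier x0 {0..} S - A}"
    by (auto simp: P_def cone_proj_def cone_carrier_def)
  then have "closedin (top_of_set ({0..} \<times> S)) P"
    using A unfolding closedin_def topspace_cone_topology openin_cone_topology
    by (auto simp: P_def prod_topology_subtopology_eu)
  then have *: "closed ((\<lambda>(t, c). F t c) ` P)"
    using closed_act_image S by blast
  \<comment> \<open>The apex is accounted for separately because for empty \<open>S\<close> the
    projection does not reach it; adding the point \<open>x0\<close> keeps the image closed.\<close>
  have "cone_map x0 F ` A = (\<lambda>(t, c). F t c) ` P \<union> (if Inl x0 \<in> A then {x0} else {})"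
  proof (intro equalityI subsetI)
    fix y assume "y \<in> cone_map x0 F ` A"
    then obtain z where z: "z \<in> A" "y = cone_map x0 F z"
      by blast
    moreover from this have "z \<in> cone_carrier x0 {0..} S"
      using A_sub by blast
    ultimately consider "z = Inl x0" | t c where "z = Inr (t, c)" "t \<in> {0..} - {0}" "c \<in> S"
      by (auto simp: cone_carrier_def)
    then show "y \<in> (\<lambda>(t, c). F t c) ` P \<union> (if Inl x0 \<in> A then {x0} else {})"
    proof cases
      case 2
      then have "(t, c) \<in> P"
        using z by (auto simp: P_def cone_proj_def)
      then show ?thesis
        using z 2 by force
    qed (use z in auto)
  next
    fix y assume y: "y \<in> (\<lambda>(t, c). F t c) ` P \<union> (if Inl x0 \<in> A then {x0} else {})"
    have "cone_map x0 F (cone_proj x0 (t, c)) = F t c" for t c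
      by (simp add: cone_proj_def act_0)
    moreover have "cone_map x0 F (Inl x0) = x0"
      by simp
    ultimately show "y \<in> cone_map x0 F ` A"
      using y by (auto simp: P_def split: if_splits intro: rev_image_eqI)
  qed
  then show "closedin euclidean (cone_map x0 F ` A)"
    using * by auto
qed

text \<open>A continuous closed bijection is a homeomorphism. The compact ball serves twice: it
  makes the sphere compact, for closedness, and forces every nonconstant orbit to cross the sphere,
  for surjectivity.\<close>

lemma homeomorphic_map_cone_map_sphere:
  assumes K: "compact (cball x0 r)" and e: "0 < e" "e \<le> r"
  shows "homeomorphic_map (cone_topology x0 {0..} (top_of_set (sphere x0 e))) euclidean
    (cone_map x0 F)"
proof (rule bijective_closed_imp_homeomorphic_map)
  show "continuous_map (cone_topology x0 {0..} (top_of_set (sphere x0 e))) euclidean (cone_map x0 F)"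
    by (rule continuous_map_cone_map)
  have "compact (cball x0 r \<inter> (cball x0 e - ball x0 e))"
    by (intro compact_Int_closed K closed_Diff) auto
  moreover have "cball x0 r \<inter> (cball x0 e - ball x0 e) = sphere x0 e"
    using e by auto
  ultimately have "compact (sphere x0 e)"
    by simp
  then show "closed_map (cone_topology x0 {0..} (top_of_set (sphere x0 e))) euclidean (cone_map x0 F)"
    using e by (intro closed_map_cone_map) auto
  have "x \<in> cone_map x0 F ` cone_carrier x0 {0..} (sphere x0 e)" for x
  proof (cases "x = x0")
    case True
    then show ?thesis
      by (intro image_eqI[of _ _ "Inl x0"]) (auto simp: cone_carrier_def)
  next
    case False
    then obtain t where "t > 0" "F t x \<in> sphere x0 e"
      using orbit_meets_sphere K e by blast
    \<comment> \<open>Moving \<open>x\<close> along its orbit by \<open>t\<close> reaches the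
      sphere, and the parameter \<open>1 / t\<close> moves it back.\<close>
    then show ?thesis
      by (intro image_eqI[of _ _ "Inr (1 / t, F t x)"])
        (auto simp: cone_carrier_def act_inverse)
  qed
  then show "cone_map x0 F ` topspace (cone_topology x0 {0..} (top_of_set (sphere x0 e)))
      = topspace euclidean"
    by (auto simp: topspace_cone_topology)
  \<comment> \<open>This separates the image of the apex from all other values; among those,
    \<open>act_sphere_inj\<close> gives injectivity.\<close>
  have "F t c \<noteq> x0" if "t > 0" "c \<in> sphere x0 e" for t c
    using that e(1) by (auto simp: act_eq_base_iff)
  then have "inj_on (cone_map x0 F) ({Inl x0} \<union> Inr ` ({0<..} \<times> sphere x0 e))"
    unfolding inj_on_def using act_sphere_inj[OF _ _ _ _ _ e(1)]
    by (safe; simp only: cone_map.simps greaterThan_iff) metis+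
  moreover have "cone_carrier x0 {0..} (sphere x0 e) = {Inl x0} \<union> Inr ` ({0<..} \<times> sphere x0 e)"
    unfolding cone_carrier_def Plus_def by fastforce
  ultimately show "inj_on (cone_map x0 F)
      (topspace (cone_topology x0 {0..} (top_of_set (sphere x0 e))))"
    by (simp add: topspace_cone_topology)
qed

end

section \<open>The homeomorphism for all small radii\<close>

theorem corollary2p9p1:
  fixes x0 :: "'a::metric_space" and F :: "real \<Rightarrow> 'a \<Rightarrow> 'a"
  assumes "locally_compact_space (euclidean :: 'a topology)"
    and "continuous_map (top_of_set {0..}) (pointed_maps_topology x0) F"
    and "inj_on F {0..}"
    and "\<And>\<alpha> \<beta>. \<lbrakk>\<alpha> \<ge> 0; \<beta> \<ge> 0\<rbrakk> \<Longrightarrow> F (\<alpha> * \<beta>) = F \<alpha> \<circ> F \<beta>"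
    and "F 0 = (\<lambda>_. x0)"
    and "F 1 = id"
    and "\<And>\<alpha> x. \<lbrakk>0 \<le> \<alpha>; \<alpha> < 1; x \<noteq> x0\<rbrakk> \<Longrightarrow> dist (F \<alpha> x) x0 < dist x x0"
  shows "\<exists>\<epsilon>0>0. \<forall>\<epsilon>. 0 < \<epsilon> \<and> \<epsilon> < \<epsilon>0 \<longrightarrow>
    homeomorphic_map (cone_topology x0 {0..} (top_of_set (frontier (ball x0 \<epsilon>)))) euclidean
      (cone_map x0 F)"
proof -
  have F: "continuous_map (top_of_set {0..}) compact_open_topology F"
    and base: "\<And>a. a \<ge> 0 \<Longrightarrow> F a x0 = x0"
    using assms(2) by (auto simp: continuous_map_in_subtopology pointed_maps_def image_subset_iff)
  interpret contracting_action F x0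
  proof
    show "(\<lambda>n. F (t n) (x n)) \<longlonglongrightarrow> F l y"
      if "t \<longlonglongrightarrow> l" "\<And>n. t n \<ge> 0" "l \<ge> 0" "x \<longlonglongrightarrow> y"
      for t :: "nat \<Rightarrow> real" and l x y
      using that by (intro compact_open_imp_tendsto_eval[OF F]) auto
  qed (use assms(4-7) base in auto)
  \<comment> \<open>The radius of a compact ball serves as the bound \<open>\<epsilon>0\<close>; the
    frontier of each smaller ball is the sphere of the same radius.\<close>
  obtain r where "r > 0" "compact (cball x0 r)"
    using locally_compact_space_imp_compact_cball[OF assms(1)] .
  then show ?thesis
    by (intro exI[of _ r])
      (auto simp: frontier_ball_eq_sphere intro!: homeomorphic_map_cone_map_sphere[of r])
qed

end
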